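(* The function $g_q(x)=\frac{1+(x-1)q}{1+(q-1)x}$ and the differential operators $D_{-1}$, $D_0$, $D_1$ satisfy: (1) $D_0(g_q)=(q^2-q+1)g_q$, $\quad D_{-1}(g_q)=q+(1-q)g_q$, $\quad D_1(g_q)=(q-1)g_q+g_q^2$; (2) $g_qD_0=(1-q)D_0+(q^2-q+1)D_1$, $\quad g_qD_{-1}=D_0+(1-q)D_1$; (3) $qg_q^{-1}D_0=(q-1)D_0+(q^2-q+1)D_{-1}$, $\quad qg_q^{-1}D_1=D_0+(q-1)D_{-1}$.
   Context: Let $q\in\mathbb{C}^*$ (or a formal parameter), $\partial=\frac{d}{dx}$, and $$D_{-1}=(1+(q-1)x)\partial,\quad D_0=(1+(x-1)q)(1+(q-1)x)\partial,\quad D_1=(1+(x-1)q)\,x\,\partial.$$ In (1), $D_i(g_q)$ is the function obtained by applying $D_i$ to $g_q$. In (2) and (3), $g_qD_i$ denotes the operator $D_i$ followed by multiplication by the function $g_q$, and $g_q^{-1}=1/g_q$ is the multiplicative inverse (not the inverse for composition). *)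

theory Defs
  imports "HOL-Analysis.Analysis" "HOL-Computational_Algebra.Polynomial"
    "HOL-Computational_Algebra.Fraction_Field"
begin

text \<open>
  The operators are defined twice: on complex functions of a complex variable, for a number
  \<open>q\<close>, and on the field \<open>K(x)\<close> of rational functions over a field \<open>K\<close> containing \<open>q\<close>. The
  second version covers a formal parameter: take \<open>K = \<complex>(q)\<close>, i.e. the type
  \<open>complex poly fract\<close>, with \<open>q\<close> the indeterminate.
\<close>

definition g_fun :: "complex \<Rightarrow> complex \<Rightarrow> complex" where
  "g_fun q x = (1 + (x - 1) * q) / (1 + (q - 1) * x)"

definition Dm1_fun :: "complex \<Rightarrow> (complex \<Rightarrow> complex) \<Rightarrow> complex \<Rightarrow> complex" where
  "Dm1_fun q f x = (1 + (q - 1) * x) * deriv f x"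

definition D0_fun :: "complex \<Rightarrow> (complex \<Rightarrow> complex) \<Rightarrow> complex \<Rightarrow> complex" where
  "D0_fun q f x = (1 + (x - 1) * q) * (1 + (q - 1) * x) * deriv f x"

definition D1_fun :: "complex \<Rightarrow> (complex \<Rightarrow> complex) \<Rightarrow> complex \<Rightarrow> complex" where
  "D1_fun q f x = (1 + (x - 1) * q) * x * deriv f x"

text \<open>
  Division by zero is total in HOL, so the domains of \<open>g_q\<close> and \<open>g_q\<inverse>\<close> have to be made explicit.
\<close>

definition g_dom :: "complex \<Rightarrow> complex set" where
  "g_dom q = {x. 1 + (q - 1) * x \<noteq> 0}"

definition g_inv_dom :: "complex \<Rightarrow> complex set" where
  "g_inv_dom q = {x \<in> g_dom q. g_fun q x \<noteq> 0}"

type_synonym 'a ratfun = "'a poly fract"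

definition rat_const :: "'a::field \<Rightarrow> 'a ratfun" where
  "rat_const c = Fract [:c:] 1"

definition rat_X :: "'a::field ratfun" where
  "rat_X = Fract [:0, 1:] 1"

text \<open>
  The derivation \<open>d/dx\<close> of \<open>K(x)\<close>, by the quotient rule on any representative; the lemma below
  shows that the result does not depend on the representative.
\<close>

definition rat_deriv :: "'a::field ratfun \<Rightarrow> 'a ratfun" where
  "rat_deriv f = (THE h. \<exists>a b. b \<noteq> 0 \<and> f = Fract a b
                          \<and> h = Fract (pderiv a * b - a * pderiv b) (b * b))"

lemma rat_deriv_Fract:
  fixes a b :: "'a::field poly"
  assumes "b \<noteq> 0"
  shows "rat_deriv (Fract a b) = Fract (pderiv a * b - a * pderiv b) (b * b)"
proof -
  have indep: "Fract (pderiv c * d - c * pderiv d) (d * d)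
             = Fract (pderiv a * b - a * pderiv b) (b * b)"
    if d: "d \<noteq> 0" and "Fract a b = Fract c d" for c d
  proof -
    have eq: "a * d = c * b"
      using that assms by (simp add: eq_fract)
    have "pderiv (a * d) = pderiv (c * b)"
      using eq by simp
    then have deq: "a * pderiv d + d * pderiv a = c * pderiv b + b * pderiv c"
      by (simp add: pderiv_mult)
    have "(pderiv a * b - a * pderiv b) * (d * d) - (pderiv c * d - c * pderiv d) * (b * b)
        = b * d * ((a * pderiv d + d * pderiv a) - (c * pderiv b + b * pderiv c))
          + (c * b - a * d) * (d * pderiv b + b * pderiv d)"
      by (simp add: algebra_simps)
    then have "(pderiv a * b - a * pderiv b) * (d * d) = (pderiv c * d - c * pderiv d) * (b * b)"
      using eq deq by simp
    then show ?thesis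
      using assms d by (simp add: eq_fract)
  qed
  show ?thesis
    unfolding rat_deriv_def
  proof (rule the_equality)
    show "\<exists>c d. d \<noteq> 0 \<and> Fract a b = Fract c d
            \<and> Fract (pderiv a * b - a * pderiv b) (b * b)
              = Fract (pderiv c * d - c * pderiv d) (d * d)"
      using assms by blast
  next
    fix h
    assume "\<exists>c d. d \<noteq> 0 \<and> Fract a b = Fract c d
              \<and> h = Fract (pderiv c * d - c * pderiv d) (d * d)"
    then show "h = Fract (pderiv a * b - a * pderiv b) (b * b)"
      using indep by blast
  qed
qed

definition g_rat :: "'a::field \<Rightarrow> 'a ratfun" where
  "g_rat q = (1 + (rat_X - 1) * rat_const q) / (1 + (rat_const q - 1) * rat_X)"

definition Dm1_rat :: "'a::field \<Rightarrow> 'a ratfun \<Rightarrow> 'a ratfun" where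
  "Dm1_rat q f = (1 + (rat_const q - 1) * rat_X) * rat_deriv f"

definition D0_rat :: "'a::field \<Rightarrow> 'a ratfun \<Rightarrow> 'a ratfun" where
  "D0_rat q f =
     (1 + (rat_X - 1) * rat_const q) * (1 + (rat_const q - 1) * rat_X) * rat_deriv f"

definition D1_rat :: "'a::field \<Rightarrow> 'a ratfun \<Rightarrow> 'a ratfun" where
  "D1_rat q f = (1 + (rat_X - 1) * rat_const q) * rat_X * rat_deriv f"

end

theory Submission
  imports Defs
begin

text \<open>
  Write \<open>g\<^sub>q = N / M\<close> with \<open>N = 1 + (x - 1) q\<close> and \<open>M = 1 + (q - 1) x\<close>. The derivative is
  \<open>g\<^sub>q' = (q\<^sup>2 - q + 1) / M\<^sup>2\<close>, and every operator involved is a multiple of \<open>\<partial>\<close>. Hence, after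
  \<open>g\<^sub>q'\<close>, respectively \<open>\<partial>f\<close>, is replaced by a field element, all seven identities hold in an
  arbitrary field; they are applied to \<open>\<complex>\<close> (pointwise in \<open>x\<close>) and to \<open>K(x)\<close>.
\<close>

lemma operators_on_g_identities:
  fixes q x :: "'a::field"
  defines "N \<equiv> 1 + (x - 1) * q" and "M \<equiv> 1 + (q - 1) * x" and "c \<equiv> q^2 - q + 1"
  assumes "M \<noteq> 0"
  shows "N * M * (c / M^2) = c * (N / M)"
    and "M * (c / M^2) = q + (1 - q) * (N / M)"
    and "N * x * (c / M^2) = (q - 1) * (N / M) + (N / M)^2"
proof -
  \<comment> \<open>Two linear relations expressing \<open>c\<close> and \<open>c * x\<close>
    through \<open>N\<close> and \<open>M\<close>. Dividing the first by \<open>M\<close> gives the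
    formula for the image under D_{-1}; multiplying the second by \<open>N / M^2\<close> gives the
    one for D_1.\<close>
  have 1: "c = q * M + (1 - q) * N" and 2: "c * x = (q - 1) * M + N"
    unfolding N_def M_def c_def by algebra+
  show "N * M * (c / M^2) = c * (N / M)"
    using assms(4) by (simp add: power2_eq_square)
  have "M * (c / M^2) = c / M"
    using assms(4) by (simp add: power2_eq_square)
  also have "\<dots> = q + (1 - q) * (N / M)"
    using assms(4) by (simp add: 1 add_divide_distrib)
  finally show "M * (c / M^2) = q + (1 - q) * (N / M)" .
  have "N * x * (c / M^2) = N * (c * x) / M^2"
    by (simp add: mult_ac)
  also have "\<dots> = (q - 1) * (N / M) + (N / M)^2"
    unfolding 2 using assms(4) by (simp add: power2_eq_square divide_simps) (simp add: algebra_simps)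
  finally show "N * x * (c / M^2) = (q - 1) * (N / M) + (N / M)^2" .
qed

text \<open>Here \<open>d\<close> stands for the derivative of the argument. After \<open>M\<close>
  cancels, the claims reduce to \<open>N = (1 - q) * M + c * x\<close> and
  \<open>1 = M + (1 - q) * x\<close>, each multiplied by \<open>d\<close> and a power of
  \<open>N\<close>.\<close>

lemma g_mult_operators_identities:
  fixes q x d :: "'a::field"
  defines "N \<equiv> 1 + (x - 1) * q" and "M \<equiv> 1 + (q - 1) * x" and "c \<equiv> q^2 - q + 1"
  assumes "M \<noteq> 0"
  shows "N / M * (N * M * d) = (1 - q) * (N * M * d) + c * (N * x * d)"
    and "N / M * (M * d) = N * M * d + (1 - q) * (N * x * d)"
proof -
  have "N / M * (N * M * d) = N * N * d" and "N / M * (M * d) = N * d"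
    using assms(4) by simp_all
  moreover have "N * N * d = (1 - q) * (N * M * d) + c * (N * x * d)"
    and "N * d = N * M * d + (1 - q) * (N * x * d)"
    unfolding N_def M_def c_def by algebra+
  ultimately show "N / M * (N * M * d) = (1 - q) * (N * M * d) + c * (N * x * d)"
    and "N / M * (M * d) = N * M * d + (1 - q) * (N * x * d)"
    by (simp_all only:)
qed

text \<open>With \<open>inverse (N / M) = M / N\<close>, which under total division also holds where
  \<open>M = 0\<close>, the factor \<open>N\<close> cancels. What remains is
  \<open>q * M = (q - 1) * N + c\<close> and \<open>q * x = N + (q - 1)\<close>, multiplied by
  \<open>M * d\<close>.\<close>

lemma g_inverse_mult_operators_identities:
  fixes q x d :: "'a::field"
  defines "N \<equiv> 1 + (x - 1) * q" and "M \<equiv> 1 + (q - 1) * x" and "c \<equiv> q^2 - q + 1"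
  assumes "N \<noteq> 0"
  shows "q * inverse (N / M) * (N * M * d) = (q - 1) * (N * M * d) + c * (M * d)"
    and "q * inverse (N / M) * (N * x * d) = N * M * d + (q - 1) * (M * d)"
proof -
  have "q * inverse (N / M) * (N * M * d) = q * M * M * d"
    and "q * inverse (N / M) * (N * x * d) = q * M * x * d"
    using assms(4) by simp_all
  moreover have "q * M * M * d = (q - 1) * (N * M * d) + c * (M * d)"
    and "q * M * x * d = N * M * d + (q - 1) * (M * d)"
    unfolding N_def M_def c_def by algebra+
  ultimately show "q * inverse (N / M) * (N * M * d) = (q - 1) * (N * M * d) + c * (M * d)"
    and "q * inverse (N / M) * (N * x * d) = N * M * d + (q - 1) * (M * d)"
    by (simp_all only:)
qed

lemma deriv_g_fun:
  assumes "x \<in> g_dom q"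
  shows "deriv (g_fun q) x = (q^2 - q + 1) / (1 + (q - 1) * x)^2"
proof -
  have "(g_fun q has_field_derivative
          (q * (1 + (q - 1) * x) - (1 + (x - 1) * q) * (q - 1))
            / ((1 + (q - 1) * x) * (1 + (q - 1) * x))) (at x)"
    unfolding g_fun_def [abs_def] using assms
    by (auto intro!: derivative_eq_intros simp: g_dom_def)
  \<comment> \<open>The quotient-rule numerator is constant in \<open>x\<close>: it is the
    determinant of the Moebius transformation \<open>g_fun q\<close>.\<close>
  moreover have "q * (1 + (q - 1) * x) - (1 + (x - 1) * q) * (q - 1) = q^2 - q + 1"
    by algebra
  ultimately show ?thesis
    by (simp add: DERIV_imp_deriv power2_eq_square)
qed

lemma rat_const_1 [simp]: "rat_const 1 = 1"
  by (simp add: rat_const_def One_fract_def one_pCons)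

lemma rat_const_add: "rat_const (a + b) = rat_const a + rat_const b"
  by (simp add: rat_const_def)

lemma rat_const_diff: "rat_const (a - b) = rat_const a - rat_const b"
  by (simp add: rat_const_def)

lemma rat_const_mult: "rat_const (a * b) = rat_const a * rat_const b"
  by (simp add: rat_const_def mult.commute)

lemma rat_const_power: "rat_const (a ^ n) = rat_const a ^ n"
  by (induction n) (simp_all add: rat_const_mult)

text \<open>Collecting numerator and denominator into explicit polynomials makes
  \<open>rat_deriv_Fract\<close> and \<open>eq_fract\<close> applicable.\<close>

lemma g_rat_numerator: "1 + (rat_X - 1) * rat_const q = Fract [:1 - q, q:] 1"
  by (simp add: rat_const_def rat_X_def One_fract_def one_pCons)

lemma g_rat_denominator: "1 + (rat_const q - 1) * rat_X = Fract [:1, q - 1:] 1"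
  by (simp add: rat_const_def rat_X_def One_fract_def one_pCons)

lemma rat_deriv_g_rat:
  "rat_deriv (g_rat q) = rat_const (q^2 - q + 1) / (1 + (rat_const q - 1) * rat_X)^2"
proof -
  have "g_rat q = Fract [:1 - q, q:] [:1, q - 1:]"
    by (simp add: g_rat_def g_rat_numerator g_rat_denominator)
  moreover have "pderiv [:1 - q, q:] * [:1, q - 1:] - [:1 - q, q:] * pderiv [:1, q - 1:]
      = [:q^2 - q + 1:]"
    by (simp add: pderiv_pCons algebra_simps power2_eq_square)
  ultimately show ?thesis
    unfolding g_rat_denominator by (simp add: rat_deriv_Fract rat_const_def power2_eq_square)
qed

lemma g_rat_numerator_nonzero: "q \<noteq> 0 \<Longrightarrow> 1 + (rat_X - 1) * rat_const q \<noteq> 0"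
  by (simp add: g_rat_numerator Zero_fract_def eq_fract)

text \<open>The constant coefficient is 1, so this holds for every \<open>q\<close>.\<close>

lemma g_rat_denominator_nonzero: "1 + (rat_const q - 1) * rat_X \<noteq> 0"
  by (simp add: g_rat_denominator Zero_fract_def eq_fract)

text \<open>Pushing \<open>rat_const\<close> down to \<open>q\<close> turns the goals over K(x) into
  instances of the field identities at \<open>rat_const q\<close> and \<open>rat_X\<close>.\<close>

lemmas rat_const_simps = rat_const_1 rat_const_add rat_const_diff rat_const_power

theorem proposition1p3:
  shows
    "(\<forall>q::complex. q \<noteq> 0 \<longrightarrow>
        (\<forall>x \<in> g_dom q.
            D0_fun q (g_fun q) x = (q^2 - q + 1) * g_fun q x
          \<and> Dm1_fun q (g_fun q) x = q + (1 - q) * g_fun q x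
          \<and> D1_fun q (g_fun q) x = (q - 1) * g_fun q x + (g_fun q x)^2)
      \<and> (\<forall>S f. open S \<longrightarrow> S \<subseteq> g_dom q \<longrightarrow> f holomorphic_on S \<longrightarrow> (\<forall>x \<in> S.
            g_fun q x * D0_fun q f x = (1 - q) * D0_fun q f x + (q^2 - q + 1) * D1_fun q f x
          \<and> g_fun q x * Dm1_fun q f x = D0_fun q f x + (1 - q) * D1_fun q f x))
      \<and> (\<forall>S f. open S \<longrightarrow> S \<subseteq> g_inv_dom q \<longrightarrow> f holomorphic_on S \<longrightarrow> (\<forall>x \<in> S.
            q * inverse (g_fun q x) * D0_fun q f x
              = (q - 1) * D0_fun q f x + (q^2 - q + 1) * Dm1_fun q f x
          \<and> q * inverse (g_fun q x) * D1_fun q f x = D0_fun q f x + (q - 1) * Dm1_fun q f x)))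
   \<and> (\<forall>q::'k::field. q \<noteq> 0 \<longrightarrow>
        (  D0_rat q (g_rat q) = rat_const (q^2 - q + 1) * g_rat q
         \<and> Dm1_rat q (g_rat q) = rat_const q + rat_const (1 - q) * g_rat q
         \<and> D1_rat q (g_rat q) = rat_const (q - 1) * g_rat q + (g_rat q)^2)
      \<and> (  (\<lambda>f. g_rat q * D0_rat q f)
             = (\<lambda>f. rat_const (1 - q) * D0_rat q f + rat_const (q^2 - q + 1) * D1_rat q f)
         \<and> (\<lambda>f. g_rat q * Dm1_rat q f)
             = (\<lambda>f. D0_rat q f + rat_const (1 - q) * D1_rat q f))
      \<and> (  (\<lambda>f. rat_const q * inverse (g_rat q) * D0_rat q f)
             = (\<lambda>f. rat_const (q - 1) * D0_rat q f + rat_const (q^2 - q + 1) * Dm1_rat q f)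
         \<and> (\<lambda>f. rat_const q * inverse (g_rat q) * D1_rat q f)
             = (\<lambda>f. D0_rat q f + rat_const (q - 1) * Dm1_rat q f)))"
\<comment> \<open>Cases 1 to 7 are the identities over the complex numbers, 8 to 14 those over K(x);
  \<open>ext\<close> reduces the operator equations 11 to 14 to their values at
  \<open>f\<close>.\<close>
proof (intro conjI allI impI ballI ext, goal_cases)
  case (1 q x)
  then have "1 + (q - 1) * x \<noteq> 0" by (simp add: g_dom_def)
  then show ?case
    \<comment> \<open>The derivative is rewritten while \<open>g_fun q\<close> is still folded; only
      then is the quotient exposed.\<close>
    unfolding D0_fun_def deriv_g_fun [OF \<open>x \<in> g_dom q\<close>] unfolding g_fun_def
    by (rule operators_on_g_identities)
next
  case (2 q x)
  then have "1 + (q - 1) * x \<noteq> 0" by (simp add: g_dom_def)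
  then show ?case
    unfolding Dm1_fun_def deriv_g_fun [OF \<open>x \<in> g_dom q\<close>] unfolding g_fun_def
    by (rule operators_on_g_identities)
next
  case (3 q x)
  then have "1 + (q - 1) * x \<noteq> 0" by (simp add: g_dom_def)
  then show ?case
    unfolding D1_fun_def deriv_g_fun [OF \<open>x \<in> g_dom q\<close>] unfolding g_fun_def
    by (rule operators_on_g_identities)
next
  case (4 q S f x)
  then have "1 + (q - 1) * x \<noteq> 0" by (auto simp: g_dom_def)
  then show ?case
    unfolding D0_fun_def D1_fun_def g_fun_def by (rule g_mult_operators_identities)
next
  case (5 q S f x)
  then have "1 + (q - 1) * x \<noteq> 0" by (auto simp: g_dom_def)
  then show ?case
    unfolding D0_fun_def D1_fun_def Dm1_fun_def g_fun_def by (rule g_mult_operators_identities)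
next
  case (6 q S f x)
  \<comment> \<open>A nonzero value of the quotient forces a nonzero numerator.\<close>
  then have "1 + (x - 1) * q \<noteq> 0" by (auto simp: g_inv_dom_def g_fun_def)
  then show ?case
    unfolding D0_fun_def Dm1_fun_def g_fun_def by (rule g_inverse_mult_operators_identities)
next
  case (7 q S f x)
  then have "1 + (x - 1) * q \<noteq> 0" by (auto simp: g_inv_dom_def g_fun_def)
  then show ?case
    unfolding D0_fun_def D1_fun_def Dm1_fun_def g_fun_def
    by (rule g_inverse_mult_operators_identities)
next
  case (8 q)
  show ?case
    unfolding D0_rat_def rat_deriv_g_rat unfolding g_rat_def rat_const_simps
    using g_rat_denominator_nonzero by (rule operators_on_g_identities)
next
  case (9 q)
  show ?case
    unfolding Dm1_rat_def rat_deriv_g_rat unfolding g_rat_def rat_const_simps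
    using g_rat_denominator_nonzero by (rule operators_on_g_identities)
next
  case (10 q)
  show ?case
    unfolding D1_rat_def rat_deriv_g_rat unfolding g_rat_def rat_const_simps
    using g_rat_denominator_nonzero by (rule operators_on_g_identities)
next
  case (11 q f)
  show ?case
    unfolding D0_rat_def D1_rat_def g_rat_def rat_const_simps
    using g_rat_denominator_nonzero by (rule g_mult_operators_identities)
next
  case (12 q f)
  show ?case
    unfolding D0_rat_def D1_rat_def Dm1_rat_def g_rat_def rat_const_simps
    using g_rat_denominator_nonzero by (rule g_mult_operators_identities)
next
  case (13 q f)
  then show ?case
    unfolding D0_rat_def Dm1_rat_def g_rat_def rat_const_simps
    by (intro g_inverse_mult_operators_identities g_rat_numerator_nonzero)
next
  case (14 q f)
  then show ?case
    unfolding D0_rat_def D1_rat_def Dm1_rat_def g_rat_def rat_const_simps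
    by (intro g_inverse_mult_operators_identities g_rat_numerator_nonzero)
qed

end
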